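(* Let $G$ be a finite non-nilpotent group. If there exists a strongly self-centralizing subgroup $U$ of $G$, then: (1) $\mathrm{nil}_G(x)=U$ for all $1\neq x\in U$; (2) $\Gamma_{\mathfrak N}(G)$ is a disconnected graph; (3) $|\mathrm{F}(G)|-1\leq \omega(\Gamma_{\mathfrak N}(G))$.
   Context: A subgroup $U$ of a finite group $G$ is said to be strongly self-centralizing if $C_G(x)=U$ for all $1\neq x\in U$, where $C_G(x)$ is the centralizer of $x$ in $G$. For $x\in G$, $\mathrm{nil}_G(x)=\{g\in G:\langle g,x\rangle\text{ is nilpotent}\}$, and $\mathrm{nil}(G)=\bigcap_{x\in G}\mathrm{nil}_G(x)$. For a finite non-nilpotent group $G$, the nilpotent graph $\Gamma_{\mathfrak N}(G)$ is the simple undirected graph with vertex set $G-\mathrm{nil}(G)$ (set difference) in which two distinct vertices $g,h$ are adjacent if and only if $\langle g,h\rangle$ is a nilpotent subgroup of $G$. $\omega(\Gamma)$ denotes the clique number of a graph $\Gamma$ (the number of vertices of a largest complete subgraph), and $\mathrm{F}(G)$ is the Fitting subgroup of $G$ (the largest normal nilpotent subgroup of $G$).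
   Formalization: The subgroup U is assumed nontrivial: the trivial subgroup is vacuously strongly self-centralizing, and with U = 1 claim (2) fails for S3 × S3 and claim (3) fails for S3 × Z2. *)

theory Defs
  imports "HOL-Algebra.Generated_Groups" "Graph_Theory.Kuratowski"
begin

definition commutator_subgroup :: "('a, 'b) monoid_scheme \<Rightarrow> 'a set \<Rightarrow> 'a set \<Rightarrow> 'a set" where
  "commutator_subgroup G A B =
     generate G (\<Union>a\<in>A. \<Union>b\<in>B. {a \<otimes>\<^bsub>G\<^esub> b \<otimes>\<^bsub>G\<^esub> inv\<^bsub>G\<^esub> a \<otimes>\<^bsub>G\<^esub> inv\<^bsub>G\<^esub> b})"

text \<open>Indexed from 0, so that term 0 is the whole group and term 1 its derived subgroup.\<close>

primrec lower_central_series :: "('a, 'b) monoid_scheme \<Rightarrow> nat \<Rightarrow> 'a set" where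
  "lower_central_series G 0 = carrier G"
| "lower_central_series G (Suc n) = commutator_subgroup G (lower_central_series G n) (carrier G)"

definition nilpotent :: "('a, 'b) monoid_scheme \<Rightarrow> bool" where
  "nilpotent G \<longleftrightarrow> (\<exists>n. lower_central_series G n = {\<one>\<^bsub>G\<^esub>})"

definition nilpotent_subgroup :: "'a set \<Rightarrow> ('a, 'b) monoid_scheme \<Rightarrow> bool" where
  "nilpotent_subgroup H G \<longleftrightarrow> subgroup H G \<and> nilpotent (G\<lparr>carrier := H\<rparr>)"

definition centralizer :: "('a, 'b) monoid_scheme \<Rightarrow> 'a \<Rightarrow> 'a set" where
  "centralizer G x = {g \<in> carrier G. g \<otimes>\<^bsub>G\<^esub> x = x \<otimes>\<^bsub>G\<^esub> g}"

text \<open>The trivial subgroup satisfies this condition vacuously; statements about strongly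
  self-centralizing subgroups have to exclude it separately where that matters.\<close>

definition strongly_self_centralizing :: "'a set \<Rightarrow> ('a, 'b) monoid_scheme \<Rightarrow> bool" where
  "strongly_self_centralizing U G \<longleftrightarrow>
     subgroup U G \<and> (\<forall>x\<in>U. x \<noteq> \<one>\<^bsub>G\<^esub> \<longrightarrow> centralizer G x = U)"

definition nil_of :: "('a, 'b) monoid_scheme \<Rightarrow> 'a \<Rightarrow> 'a set" where
  "nil_of G x = {g \<in> carrier G. nilpotent_subgroup (generate G {g, x}) G}"

definition nil :: "('a, 'b) monoid_scheme \<Rightarrow> 'a set" where
  "nil G = (\<Inter>x\<in>carrier G. nil_of G x)"

text \<open>Undirected graphs are represented as symmetric digraphs (locale \<open>graph\<close>).\<close>

definition nilpotent_graph :: "('a, 'b) monoid_scheme \<Rightarrow> ('a, 'a \<times> 'a) pre_digraph" where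
  "nilpotent_graph G = with_proj
     \<lparr> pverts = carrier G - nil G,
       parcs = {(g, h). g \<in> carrier G - nil G \<and> h \<in> carrier G - nil G \<and> g \<noteq> h
                        \<and> nilpotent_subgroup (generate G {g, h}) G} \<rparr>"

lemma graph_nilpotent_graph:
  assumes "finite (carrier G)"
  shows "graph (nilpotent_graph G)"
proof -
  have "finite {(g, h). g \<in> carrier G - nil G \<and> h \<in> carrier G - nil G \<and> g \<noteq> h
                        \<and> nilpotent_subgroup (generate G {g, h}) G}"
    by (rule finite_subset[of _ "carrier G \<times> carrier G"]) (use assms in auto)
  then show ?thesis
    using assms unfolding nilpotent_graph_def
    by unfold_locales
      (auto simp: arc_to_ends_def symmetric_def insert_commute intro!: symI)
qed

text \<open>Intended for finite graphs only, as \<open>Max\<close> is taken over the orders of the complete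
  subgraphs.\<close>

definition clique_number :: "('a, 'b) pre_digraph \<Rightarrow> nat" where
  "clique_number \<Gamma> = Max {n. \<exists>H. subgraph H \<Gamma> \<and> complete_digraph n H}"

text \<open>\<open>GREATEST\<close> refers to inclusion. For finite groups the greatest element exists by
  Fitting's theorem.\<close>

definition fitting_subgroup :: "('a, 'b) monoid_scheme \<Rightarrow> 'a set" where
  "fitting_subgroup G = (GREATEST N. N \<lhd> G \<and> nilpotent_subgroup N G)"

end

theory Submission
  imports Defs
begin

text \<open>
  Everything rests on one property of nilpotent groups: a nontrivial one has a nontrivial centre.
  Let \<open>1 \<noteq> x \<in> U\<close>. If \<open>\<langle>g, x\<rangle>\<close> is nilpotent, choose \<open>z \<noteq> 1\<close> in its centre. Then \<open>z\<close> commutes with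
  \<open>x\<close>, so \<open>z \<in> C(x) = U\<close>, hence \<open>C(z) = U\<close>, and \<open>g\<close>, which commutes with \<open>z\<close>, lies in \<open>U\<close>.
  Conversely \<open>U\<close> is abelian, so \<open>\<langle>g, x\<rangle>\<close> is nilpotent for every \<open>g \<in> U\<close>. This is the first claim.

  It says that in the nilpotent graph no edge joins a nontrivial element of \<open>U\<close> to an element
  outside \<open>U\<close>. Both kinds of vertices occur: \<open>U \<noteq> G\<close> because \<open>U\<close> is abelian and \<open>G\<close> is not
  nilpotent, and \<open>nil(G) = {1}\<close> because \<open>1 \<noteq> z \<in> nil(G)\<close> would give \<open>z \<in> U\<close> and then
  \<open>U = nil\<^sub>G(z) = G\<close>. So the graph is disconnected.

  For the third claim, any two elements of a nilpotent subgroup generate a nilpotent subgroup, so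
  the nontrivial elements of the Fitting subgroup form a clique. As the Fitting subgroup is
  introduced as a greatest element, this needs that the greatest element exists, which is Fitting's
  theorem: the join of two nilpotent normal subgroups \<open>M\<close> and \<open>N\<close> is nilpotent. Writing
  \<open>M\<^sub>i = [G, M, \<dots>, M]\<close> with \<open>i\<close> factors \<open>M\<close>, and \<open>N\<^sub>j\<close> likewise, commuting an element of
  \<open>M\<^sub>i \<inter> N\<^sub>j\<close> with an element of \<open>M\<close> raises \<open>i\<close>, and with an element of \<open>N\<close> raises \<open>j\<close>. The
  subgroups generated by all \<open>M\<^sub>i \<inter> N\<^sub>j\<close> with \<open>i + j = k\<close> therefore form a descending chain in \<open>k\<close>
  that is central for \<open>\<langle>M, N\<rangle>\<close> and ends in the trivial subgroup.
\<close>

section \<open>Commutators and central chains\<close>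

abbreviation (in group) commutator :: "'a \<Rightarrow> 'a \<Rightarrow> 'a" where
  "commutator a b \<equiv> a \<otimes> b \<otimes> inv a \<otimes> inv b"

context group
begin

lemma inv_mult_cancel:
  assumes "a \<in> carrier G" "b \<in> carrier G"
  shows "inv a \<otimes> (a \<otimes> b) = b"
  using assms by (simp add: m_assoc[symmetric])

lemma normal_imp_subset: "N \<lhd> G \<Longrightarrow> N \<subseteq> carrier G"
  by (rule subgroup.subset[OF normal_imp_subgroup])

lemma commutator_eq_one_iff:
  assumes "a \<in> carrier G" "b \<in> carrier G"
  shows "commutator a b = \<one> \<longleftrightarrow> a \<otimes> b = b \<otimes> a"
proof -
  have "commutator a b = a \<otimes> b \<otimes> inv (b \<otimes> a)"
    using assms by (simp add: inv_mult_group m_assoc)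
  then show ?thesis
    using assms by (metis inv_closed inv_equality inv_inv m_closed r_inv)
qed

lemma inv_commutator:
  assumes "a \<in> carrier G" "b \<in> carrier G"
  shows "inv (commutator a b) = commutator b a"
  using assms by (simp add: inv_mult_group m_assoc)

lemma commutator_in_normal_left:
  assumes "N \<lhd> G" "a \<in> N" "b \<in> carrier G"
  shows "commutator a b \<in> N"
proof -
  interpret N: normal N G by fact
  have a: "a \<in> carrier G" using assms(2) by (rule N.mem_carrier)
  have "commutator a b = a \<otimes> (b \<otimes> inv a \<otimes> inv b)"
    using a assms(3) by (simp add: m_assoc)
  then show ?thesis
    using assms a N.inv_op_closed2 by simp
qed

lemma commutator_in_normal_right:
  assumes "N \<lhd> G" "a \<in> carrier G" "b \<in> N"
  shows "commutator a b \<in> N"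
proof -
  interpret N: normal N G by fact
  show ?thesis using assms N.inv_op_closed2 by simp
qed

text \<open>The set below is the preimage of a centralizer in the quotient \<open>G / P\<close>.\<close>

lemma subgroup_commutator_into_normal:
  assumes P: "P \<lhd> G" and x: "x \<in> carrier G"
  shows "subgroup {g \<in> carrier G. commutator x g \<in> P} G"
proof -
  interpret P: normal P G by fact
  show ?thesis
  proof (rule subgroupI)
    show "{g \<in> carrier G. commutator x g \<in> P} \<noteq> {}"
      using x by (auto intro!: exI[of _ \<one>])
  next
    fix g assume g: "g \<in> {g \<in> carrier G. commutator x g \<in> P}"
    have "commutator x (inv g) = inv g \<otimes> commutator g x \<otimes> g"
      using x g by (simp add: m_assoc[symmetric])
    moreover have "commutator g x \<in> P"
      using g x inv_commutator[of x g] P.m_inv_closed[of "commutator x g"] by simp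
    ultimately show "inv g \<in> {g \<in> carrier G. commutator x g \<in> P}"
      using g P.inv_op_closed1 by simp
  next
    fix g h
    assume g: "g \<in> {g \<in> carrier G. commutator x g \<in> P}"
      and h: "h \<in> {g \<in> carrier G. commutator x g \<in> P}"
    have "commutator x (g \<otimes> h) = commutator x g \<otimes> (g \<otimes> commutator x h \<otimes> inv g)"
      using x g h by (simp add: inv_mult_group m_assoc inv_mult_cancel)
    then show "g \<otimes> h \<in> {g \<in> carrier G. commutator x g \<in> P}"
      using g h P.inv_op_closed2 by simp
  qed auto
qed

text \<open>Modulo \<open>P\<close>, everything that commutes with \<open>B\<close> elementwise forms a subgroup, and likewise with
  the roles exchanged. So it is enough to test commutation on generators.\<close>

lemma commutator_generate_into_normal:
  assumes P: "P \<lhd> G" and A: "A \<subseteq> carrier G" and B: "B \<subseteq> carrier G"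
    and AB: "\<And>a b. a \<in> A \<Longrightarrow> b \<in> B \<Longrightarrow> commutator a b \<in> P"
    and a: "a \<in> generate G A" and b: "b \<in> generate G B"
  shows "commutator a b \<in> P"
proof -
  interpret P: normal P G by fact
  have swap: "commutator u v \<in> P" if "commutator v u \<in> P" "u \<in> carrier G" "v \<in> carrier G" for u v
    using that inv_commutator[of v u] P.m_inv_closed[of "commutator v u"] by simp
  have bc: "b \<in> carrier G" using b B generate_in_carrier by blast
  have "commutator a b \<in> P" if a: "a \<in> A" for a
  proof -
    have "generate G B \<subseteq> {g \<in> carrier G. commutator a g \<in> P}"
      by (rule generate_subgroup_incl) (use a A B AB P in \<open>auto intro!: subgroup_commutator_into_normal\<close>)
    then show ?thesis using b by auto
  qed
  then have "A \<subseteq> {g \<in> carrier G. commutator b g \<in> P}"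
    using A bc swap by blast
  then have "generate G A \<subseteq> {g \<in> carrier G. commutator b g \<in> P}"
    by (rule generate_subgroup_incl) (rule subgroup_commutator_into_normal[OF P bc])
  then show ?thesis using a bc swap by blast
qed

lemma commutator_in_commutator_subgroup:
  "a \<in> A \<Longrightarrow> b \<in> B \<Longrightarrow> commutator a b \<in> commutator_subgroup G A B"
  unfolding commutator_subgroup_def by (rule generate.incl) auto

lemma commutator_subgroup_least:
  assumes "subgroup K G" "\<And>a b. a \<in> A \<Longrightarrow> b \<in> B \<Longrightarrow> commutator a b \<in> K"
  shows "commutator_subgroup G A B \<subseteq> K"
  unfolding commutator_subgroup_def by (rule generate_subgroup_incl) (use assms in auto)

lemma subgroup_commutator_subgroup:
  assumes "A \<subseteq> carrier G" "B \<subseteq> carrier G"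
  shows "subgroup (commutator_subgroup G A B) G"
  unfolding commutator_subgroup_def
  by (rule generate_is_subgroup) (use assms[THEN subsetD] in auto)

lemma normal_commutator_subgroup:
  assumes A: "A \<lhd> G" and B: "B \<lhd> G"
  shows "commutator_subgroup G A B \<lhd> G"
  unfolding commutator_subgroup_def
proof (rule normal_generateI)
  interpret A: normal A G by fact
  interpret B: normal B G by fact
  show "(\<Union>a\<in>A. \<Union>b\<in>B. {commutator a b}) \<subseteq> carrier G" by auto
  fix h g assume "h \<in> (\<Union>a\<in>A. \<Union>b\<in>B. {commutator a b})" and g: "g \<in> carrier G"
  then obtain a b where ab: "a \<in> A" "b \<in> B" "h = commutator a b" by auto
  have "g \<otimes> h \<otimes> inv g = commutator (g \<otimes> a \<otimes> inv g) (g \<otimes> b \<otimes> inv g)"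
    using ab g by (simp add: inv_mult_group m_assoc inv_mult_cancel)
  moreover have "g \<otimes> a \<otimes> inv g \<in> A" "g \<otimes> b \<otimes> inv g \<in> B"
    using ab g A.inv_op_closed2 B.inv_op_closed2 by auto
  ultimately show "g \<otimes> h \<otimes> inv g \<in> (\<Union>a\<in>A. \<Union>b\<in>B. {commutator a b})" by blast
qed

lemma commutator_subgroup_restrict:
  assumes H: "subgroup H G" and "A \<subseteq> H" "B \<subseteq> H"
  shows "commutator_subgroup (G\<lparr>carrier := H\<rparr>) A B = commutator_subgroup G A B"
proof -
  interpret H: subgroup H G by fact
  have inv: "inv\<^bsub>G\<lparr>carrier := H\<rparr>\<^esub> a = inv a" if "a \<in> H" for a
    using m_inv_consistent[OF H that] .
  have "(\<Union>a\<in>A. \<Union>b\<in>B. {a \<otimes> b \<otimes> inv\<^bsub>G\<lparr>carrier := H\<rparr>\<^esub> a \<otimes> inv\<^bsub>G\<lparr>carrier := H\<rparr>\<^esub> b})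
      = (\<Union>a\<in>A. \<Union>b\<in>B. {commutator a b})"
    using assms(2,3) inv by (intro SUP_cong refl) (auto simp: subset_iff)
  moreover have "(\<Union>a\<in>A. \<Union>b\<in>B. {commutator a b}) \<subseteq> H"
    using assms(2,3)[THEN subsetD] by auto
  ultimately show ?thesis
    unfolding commutator_subgroup_def by (simp add: generate_consistent[OF _ H])
qed

lemma subgroup_lower_central_series: "subgroup (lower_central_series G n) G"
  by (induction n) (auto intro: subgroup_self subgroup_commutator_subgroup dest: subgroup.subset)

lemma subgroup_lower_central_series_restrict:
  assumes "subgroup H G"
  shows "subgroup (lower_central_series (G\<lparr>carrier := H\<rparr>) n) G"
  using group.subgroup_lower_central_series[OF subgroup_imp_group[OF assms]]
    incl_subgroup[OF assms] by blast

lemma lower_central_series_restrict_Suc: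
  assumes "subgroup H G"
  shows "lower_central_series (G\<lparr>carrier := H\<rparr>) (Suc n) =
    commutator_subgroup G (lower_central_series (G\<lparr>carrier := H\<rparr>) n) H"
  using commutator_subgroup_restrict[OF assms, of "lower_central_series (G\<lparr>carrier := H\<rparr>) n" H]
    subgroup.subset[OF group.subgroup_lower_central_series[OF subgroup_imp_group[OF assms]]]
  by simp

text \<open>The lower central series descends at least as fast as any other central chain. The chain may
  start above \<open>H\<close> and run outside it, so the chain of a larger group can be used.\<close>

lemma nilpotent_subgroup_if_central_chain:
  assumes H: "subgroup H G" and S: "\<And>i. subgroup (S i) G" and "H \<subseteq> S 0"
    and step: "\<And>i a h. a \<in> S i \<Longrightarrow> h \<in> H \<Longrightarrow> commutator a h \<in> S (Suc i)"
    and "S n = {\<one>}"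
  shows "nilpotent_subgroup H G"
proof -
  have "lower_central_series (G\<lparr>carrier := H\<rparr>) i \<subseteq> S i" for i
  proof (induction i)
    case (Suc i)
    then show ?case
      unfolding lower_central_series_restrict_Suc[OF H]
      by (intro commutator_subgroup_least S step) auto
  qed (use assms in simp)
  then have "lower_central_series (G\<lparr>carrier := H\<rparr>) n \<subseteq> {\<one>}"
    using \<open>S n = {\<one>}\<close> by metis
  then have "lower_central_series (G\<lparr>carrier := H\<rparr>) n = {\<one>}"
    using subgroup.one_closed[OF subgroup_lower_central_series_restrict[OF H]] by blast
  then show ?thesis
    using H unfolding nilpotent_subgroup_def nilpotent_def by auto
qed

lemma nilpotent_subgroup_if_commuting:
  assumes H: "subgroup H G" and comm: "\<And>a b. a \<in> H \<Longrightarrow> b \<in> H \<Longrightarrow> a \<otimes> b = b \<otimes> a"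
  shows "nilpotent_subgroup H G"
proof (rule nilpotent_subgroup_if_central_chain[OF H, of "\<lambda>i. if i = 0 then H else {\<one>}" 1])
  interpret H: subgroup H G by fact
  fix i :: nat and a h
  assume "a \<in> (if i = 0 then H else {\<one>})" "h \<in> H"
  then have "a \<in> H" "h \<in> H" by (auto split: if_splits)
  then have "commutator a h = \<one>"
    using comm commutator_eq_one_iff H.mem_carrier by blast
  then show "commutator a h \<in> (if Suc i = 0 then H else {\<one>})" by simp
qed (use H triv_subgroup in auto)

lemma nilpotent_subgroup_mono:
  assumes K: "subgroup K G" and "K \<subseteq> H" and nil: "nilpotent_subgroup H G"
  shows "nilpotent_subgroup K G"
proof -
  have H: "subgroup H G" using nil unfolding nilpotent_subgroup_def by simp
  obtain n where n: "lower_central_series (G\<lparr>carrier := H\<rparr>) n = {\<one>}"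
    using nil unfolding nilpotent_subgroup_def nilpotent_def by auto
  show ?thesis
  proof (rule nilpotent_subgroup_if_central_chain
      [where S = "lower_central_series (G\<lparr>carrier := H\<rparr>)" and n = n, OF K])
    show "subgroup (lower_central_series (G\<lparr>carrier := H\<rparr>) i) G" for i
      by (rule subgroup_lower_central_series_restrict[OF H])
    show "commutator a h \<in> lower_central_series (G\<lparr>carrier := H\<rparr>) (Suc i)"
      if "a \<in> lower_central_series (G\<lparr>carrier := H\<rparr>) i" "h \<in> K" for i a h
      unfolding lower_central_series_restrict_Suc[OF H]
      using that \<open>K \<subseteq> H\<close> by (blast intro: commutator_in_commutator_subgroup)
  qed (use n \<open>K \<subseteq> H\<close> in simp_all)
qed

text \<open>The last nontrivial term of the lower central series is central.\<close>

lemma nilpotent_obtains_central: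
  assumes "nilpotent G" "carrier G \<noteq> {\<one>}"
  obtains z where "z \<in> carrier G" "z \<noteq> \<one>" "\<And>g. g \<in> carrier G \<Longrightarrow> z \<otimes> g = g \<otimes> z"
proof -
  obtain n where "lower_central_series G n = {\<one>}"
    using assms unfolding nilpotent_def by auto
  moreover have "lower_central_series G 0 \<noteq> {\<one>}"
    using assms by simp
  ultimately obtain m where m: "lower_central_series G m \<noteq> {\<one>}"
    "lower_central_series G (Suc m) = {\<one>}"
    using ex_least_nat_less[of "\<lambda>i. lower_central_series G i = {\<one>}" n]
    by (metis Suc_eq_plus1 le_refl)
  have sub: "subgroup (lower_central_series G m) G" by (rule subgroup_lower_central_series)
  obtain z where z: "z \<in> lower_central_series G m" "z \<noteq> \<one>"
    using m(1) subgroup.one_closed[OF sub] by blast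
  have zc: "z \<in> carrier G" using z subgroup.mem_carrier[OF sub] by blast
  moreover have "z \<otimes> g = g \<otimes> z" if "g \<in> carrier G" for g
    using commutator_in_commutator_subgroup[OF z(1) that] m(2) commutator_eq_one_iff[OF zc that] by simp
  ultimately show thesis using z that by blast
qed

lemma nilpotent_subgroup_obtains_central:
  assumes "nilpotent_subgroup H G" "H \<noteq> {\<one>}"
  obtains z where "z \<in> H" "z \<noteq> \<one>" "\<And>h. h \<in> H \<Longrightarrow> z \<otimes> h = h \<otimes> z"
proof -
  have H: "subgroup H G" "nilpotent (G\<lparr>carrier := H\<rparr>)"
    using assms unfolding nilpotent_subgroup_def by auto
  show thesis
    by (rule group.nilpotent_obtains_central[OF subgroup_imp_group[OF H(1)] H(2)])
      (use assms(2) that in auto)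
qed

lemma nilpotent_subgroup_generate_mono:
  assumes "nilpotent_subgroup H G" "A \<subseteq> H"
  shows "nilpotent_subgroup (generate G A) G"
proof -
  have H: "subgroup H G" using assms unfolding nilpotent_subgroup_def by simp
  then have "A \<subseteq> carrier G" using assms(2) subgroup.subset by blast
  then show ?thesis
    by (intro nilpotent_subgroup_mono[OF _ _ assms(1)] generate_is_subgroup
        generate_subgroup_incl[OF assms(2) H])
qed

end

section \<open>Fitting's theorem\<close>

text \<open>Starting at \<open>G\<close> instead of \<open>H\<close> makes the index count the factors \<open>H\<close> only. In a commutator
  with factors from two normal subgroups, the factors of each can then be counted independently,
  from zero on.\<close>

primrec iterated_commutator :: "('a, 'b) monoid_scheme \<Rightarrow> 'a set \<Rightarrow> nat \<Rightarrow> 'a set" where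
  "iterated_commutator G H 0 = carrier G"
| "iterated_commutator G H (Suc n) = commutator_subgroup G (iterated_commutator G H n) H"

context group
begin

lemma normal_iterated_commutator:
  "H \<lhd> G \<Longrightarrow> iterated_commutator G H n \<lhd> G"
  by (induction n) (auto intro: normal_self normal_commutator_subgroup)

lemma iterated_commutator_antimono:
  assumes H: "H \<lhd> G" and "m \<le> n"
  shows "iterated_commutator G H n \<subseteq> iterated_commutator G H m"
proof (rule lift_Suc_antimono_le[OF _ \<open>m \<le> n\<close>])
  interpret H: normal H G by fact
  fix n
  show "iterated_commutator G H (Suc n) \<subseteq> iterated_commutator G H n"
    unfolding iterated_commutator.simps
    using normal_iterated_commutator[OF H]
    by (intro commutator_subgroup_least normal_imp_subgroup commutator_in_normal_left) auto
qed

text \<open>The index shifts by one because \<open>[G, H] \<le> H\<close> for normal \<open>H\<close>: after one step the iterated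
  commutator has entered \<open>H\<close>, where the lower central series of \<open>H\<close> begins.\<close>

lemma iterated_commutator_subset_lower_central_series:
  assumes H: "H \<lhd> G"
  shows "iterated_commutator G H (Suc n) \<subseteq> lower_central_series (G\<lparr>carrier := H\<rparr>) n"
proof (induction n)
  case 0
  show ?case
    using commutator_subgroup_least[OF normal_imp_subgroup[OF H] commutator_in_normal_right[OF H]]
    by simp
next
  case (Suc n)
  have sub: "subgroup H G" by (rule normal_imp_subgroup[OF H])
  show ?case
    unfolding lower_central_series_restrict_Suc[OF sub] iterated_commutator.simps(2)[of G H "Suc n"]
    using Suc
    by (intro commutator_subgroup_least subgroup_commutator_subgroup
        commutator_in_commutator_subgroup subgroup.subset[OF sub]
        subgroup.subset[OF subgroup_lower_central_series_restrict[OF sub]]) auto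
qed

lemma nilpotent_normal_iterated_commutator_trivial:
  assumes "H \<lhd> G" "nilpotent_subgroup H G"
  obtains n where "iterated_commutator G H n = {\<one>}"
proof -
  obtain n where "lower_central_series (G\<lparr>carrier := H\<rparr>) n = {\<one>}"
    using assms unfolding nilpotent_subgroup_def nilpotent_def by auto
  then have "iterated_commutator G H (Suc n) \<subseteq> {\<one>}"
    using iterated_commutator_subset_lower_central_series[OF assms(1), of n] by simp
  then have "iterated_commutator G H (Suc n) = {\<one>}"
    using subgroup.one_closed[OF normal_imp_subgroup[OF normal_iterated_commutator[OF assms(1)]]]
    by blast
  then show thesis by (rule that)
qed

lemma normal_generate_Union:
  assumes "\<And>N. N \<in> \<N> \<Longrightarrow> N \<lhd> G"
  shows "generate G (\<Union>\<N>) \<lhd> G"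
proof (rule normal_generateI)
  show "\<Union>\<N> \<subseteq> carrier G"
    using assms normal_imp_subset by auto
  fix h g assume "h \<in> \<Union>\<N>" and g: "g \<in> carrier G"
  then obtain N where N: "N \<in> \<N>" "h \<in> N" by blast
  have "g \<otimes> h \<otimes> inv g \<in> N"
    by (rule normal.inv_op_closed2[OF assms[OF N(1)] g N(2)])
  then show "g \<otimes> h \<otimes> inv g \<in> \<Union>\<N>" using N(1) by blast
qed

text \<open>The central chain of the join is generated in degree \<open>k\<close> by the \<open>M\<^sub>i \<inter> N\<^sub>j\<close> with
  \<open>i + j = k\<close>. If \<open>M\<^sub>m\<close> and \<open>N\<^sub>n\<close> are trivial, it ends in degree \<open>m + n\<close>, as \<open>i + j = m + n\<close>
  forces \<open>i \<ge> m\<close> or \<open>j \<ge> n\<close>.\<close>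

theorem nilpotent_subgroup_join:
  assumes M: "M \<lhd> G" "nilpotent_subgroup M G" and N: "N \<lhd> G" "nilpotent_subgroup N G"
  shows "nilpotent_subgroup (generate G (M \<union> N)) G"
proof -
  define \<M> where "\<M> = iterated_commutator G M"
  define \<N> where "\<N> = iterated_commutator G N"
  define A where "A k = (\<Union>((\<lambda>i. \<M> i \<inter> \<N> (k - i)) ` {..k}))" for k
  obtain m where m: "\<M> m = {\<one>}"
    using nilpotent_normal_iterated_commutator_trivial[OF M] unfolding \<M>_def .
  obtain n where n: "\<N> n = {\<one>}"
    using nilpotent_normal_iterated_commutator_trivial[OF N] unfolding \<N>_def .
  have nM: "\<M> i \<lhd> G" and nN: "\<N> i \<lhd> G" for i
    unfolding \<M>_def \<N>_def by (simp_all add: normal_iterated_commutator M N)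
  have MNc: "M \<union> N \<subseteq> carrier G"
    using M N normal_imp_subset by simp
  have Ac: "A k \<subseteq> carrier G" for k
    unfolding A_def using normal_imp_subset[OF nM] by blast
  have normal: "generate G (A k) \<lhd> G" for k
    unfolding A_def
    by (rule normal_generate_Union) (auto intro: normal_subgroup_intersect nM nN)
  have step: "commutator a b \<in> generate G (A (Suc k))" if a: "a \<in> A k" and b: "b \<in> M \<union> N" for a b k
  proof -
    obtain i where i: "i \<le> k" "a \<in> \<M> i" "a \<in> \<N> (k - i)"
      using a unfolding A_def by auto
    have bc: "b \<in> carrier G" using b MNc by blast
    \<comment> \<open>Normality preserves both degrees, and the factor \<open>b\<close> raises one of them.\<close>
    have stay: "commutator a b \<in> \<M> i" "commutator a b \<in> \<N> (k - i)"
      using i bc commutator_in_normal_left nM nN by blast+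
    from b have "commutator a b \<in> A (Suc k)"
    proof
      assume "b \<in> M"
      then have "commutator a b \<in> \<M> (Suc i)"
        using i(2) unfolding \<M>_def by (simp add: commutator_in_commutator_subgroup)
      then have "commutator a b \<in> \<M> (Suc i) \<inter> \<N> (Suc k - Suc i)" using stay by simp
      then show ?thesis unfolding A_def using i(1) by blast
    next
      assume "b \<in> N"
      then have "commutator a b \<in> \<N> (Suc (k - i))"
        using i(3) unfolding \<N>_def by (simp add: commutator_in_commutator_subgroup)
      then have "commutator a b \<in> \<M> i \<inter> \<N> (Suc k - i)" using stay i(1) by (simp add: Suc_diff_le)
      then show ?thesis unfolding A_def using i(1) by (meson UN_I atMost_iff le_SucI)
    qed
    then show ?thesis by (rule generate.incl)
  qed
  have "A (m + n) \<subseteq> {\<one>}"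
  proof -
    have "\<M> i \<inter> \<N> (m + n - i) \<subseteq> {\<one>}" for i
    proof (cases "m \<le> i")
      case True
      then show ?thesis
        using iterated_commutator_antimono[OF M(1)] m unfolding \<M>_def by blast
    next
      case False
      then have "n \<le> m + n - i" by simp
      then show ?thesis
        using iterated_commutator_antimono[OF N(1)] n unfolding \<N>_def by blast
    qed
    then show ?thesis unfolding A_def by blast
  qed
  then have "generate G (A (m + n)) \<subseteq> {\<one>}"
    by (rule generate_subgroup_incl) (rule triv_subgroup)
  then have trivial: "generate G (A (m + n)) = {\<one>}"
    using generate.one by blast
  show ?thesis
  proof (rule nilpotent_subgroup_if_central_chain
      [where S = "\<lambda>k. generate G (A k)" and n = "m + n"])
    show "subgroup (generate G (M \<union> N)) G"
      by (rule generate_is_subgroup[OF MNc])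
    show "subgroup (generate G (A i)) G" for i
      by (rule generate_is_subgroup[OF Ac])
    have "A 0 = carrier G" unfolding A_def \<M>_def \<N>_def by simp
    then show "generate G (M \<union> N) \<subseteq> generate G (A 0)"
      using MNc by (simp add: mono_generate)
    show "commutator a h \<in> generate G (A (Suc i))"
      if "a \<in> generate G (A i)" "h \<in> generate G (M \<union> N)" for i a h
      by (rule commutator_generate_into_normal[OF normal Ac MNc step that])
  qed (rule trivial)
qed

text \<open>A nilpotent normal subgroup of maximal order absorbs every other one, because their join is
  again nilpotent and normal.\<close>

lemma fitting_subgroup_normal_nilpotent:
  assumes fin: "finite (carrier G)"
  shows "fitting_subgroup G \<lhd> G \<and> nilpotent_subgroup (fitting_subgroup G) G"
proof -
  define Q where "Q N \<longleftrightarrow> N \<lhd> G \<and> nilpotent_subgroup N G" for N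
  have "Q {\<one>}"
    unfolding Q_def by (auto intro: one_is_normal nilpotent_subgroup_if_commuting triv_subgroup)
  moreover have bound: "N \<subseteq> carrier G" if "Q N" for N
    using that normal_imp_subset unfolding Q_def by simp
  ultimately obtain F where F: "Q F" "\<And>N. Q N \<Longrightarrow> card N \<le> card F"
    using ex_has_greatest_nat[of Q "{\<one>}" card "Suc (card (carrier G))"]
    by (metis card_mono fin less_Suc_eq_le)
  have "N \<subseteq> F" if N: "Q N" for N
  proof -
    let ?J = "generate G (F \<union> N)"
    have "?J \<lhd> G"
      using normal_generate_Union[of "{F, N}"] F(1) N unfolding Q_def by auto
    then have "Q ?J"
      using nilpotent_subgroup_join F(1) N unfolding Q_def by blast
    moreover have "F \<union> N \<subseteq> ?J" by (auto intro: generate.incl)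
    ultimately have "F = ?J"
      using F(2) bound by (intro card_seteq) (auto intro: finite_subset[OF _ fin])
    then show ?thesis using \<open>F \<union> N \<subseteq> ?J\<close> by blast
  qed
  then have "fitting_subgroup G = F"
    unfolding fitting_subgroup_def Q_def[symmetric] using F(1) by (intro Greatest_equality)
  then show ?thesis using F(1) unfolding Q_def by simp
qed

end

section \<open>Connectedness and cliques\<close>

lemma not_connected_if_no_crossing_arc:
  assumes "u \<in> verts \<Gamma>" "u \<in> A" "v \<in> verts \<Gamma>" "v \<notin> A"
    and arcs: "\<And>a b. (a, b) \<in> arcs_ends \<Gamma> \<Longrightarrow> a \<in> A \<longleftrightarrow> b \<in> A"
  shows "\<not> Digraph_Component.connected \<Gamma>"
proof
  assume "Digraph_Component.connected \<Gamma>"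
  then have "(u, v) \<in> rtrancl_on (verts \<Gamma>) ((arcs_ends \<Gamma>)\<^sup>s)"
    using assms by (simp add: connected_conv)
  then have "v \<in> A"
  proof (induction rule: rtrancl_on_induct)
    case (step x y)
    then show ?case using arcs by (auto simp: symcl_def)
  qed (rule \<open>u \<in> A\<close>)
  then show False using \<open>v \<notin> A\<close> by simp
qed

lemma card_le_clique_number:
  assumes \<Gamma>: "graph (with_proj P)" and C: "C \<subseteq> pverts P"
    and adj: "\<And>u v. u \<in> C \<Longrightarrow> v \<in> C \<Longrightarrow> u \<noteq> v \<Longrightarrow> (u, v) \<in> parcs P"
  shows "card C \<le> clique_number (with_proj P)"
proof -
  interpret graph "with_proj P" by fact
  let ?H = "\<lparr>pverts = C, parcs = {(u, v). (u, v) \<in> C \<times> C \<and> u \<noteq> v}\<rparr>"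
  have "finite C" using C finite_verts finite_subset by auto
  then have complete: "complete_digraph (card C) (with_proj ?H)"
    by (simp add: complete_digraph_pair_def)
  then interpret H: graph "with_proj ?H" unfolding complete_digraph_def by simp
  have "subgraph (with_proj ?H) (with_proj P)"
    unfolding subgraph_def using C adj wf_digraph_axioms H.wf_digraph_axioms by auto
  then have "card C \<in> {n. \<exists>H. subgraph H (with_proj P) \<and> complete_digraph n H}"
    using complete by blast
  moreover have "finite {n. \<exists>H. subgraph H (with_proj P) \<and> complete_digraph n H}"
  proof (rule finite_subset)
    show "{n. \<exists>H. subgraph H (with_proj P) \<and> complete_digraph n H} \<subseteq> {..card (pverts P)}"
      using finite_verts by (auto simp: subgraph_def complete_digraph_def intro: card_mono)
  qed simp
  ultimately show ?thesis unfolding clique_number_def by (rule Max_ge[rotated])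
qed

section \<open>Strongly self-centralizing subgroups\<close>

context group
begin

lemma generate_pair_incl:
  "g \<in> generate G {g, x}" "x \<in> generate G {g, x}"
  by (auto intro: generate.incl)

lemma strongly_self_centralizing_commute:
  assumes U: "strongly_self_centralizing U G" and "a \<in> U" "b \<in> U"
  shows "a \<otimes> b = b \<otimes> a"
proof (cases "b = \<one>")
  case True
  then show ?thesis
    using assms subgroup.mem_carrier unfolding strongly_self_centralizing_def by force
next
  case False
  then have "a \<in> centralizer G b"
    using assms unfolding strongly_self_centralizing_def by blast
  then show ?thesis unfolding centralizer_def by simp
qed

lemma strongly_self_centralizing_nilpotent:
  assumes "strongly_self_centralizing U G"
  shows "nilpotent_subgroup U G"
  using assms strongly_self_centralizing_commute unfolding strongly_self_centralizing_def
  by (intro nilpotent_subgroup_if_commuting) auto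

text \<open>A nontrivial central element \<open>z\<close> of \<open>\<langle>g, x\<rangle>\<close> links \<open>g\<close> to \<open>x\<close>: it commutes with \<open>x\<close>, which
  puts it into \<open>U\<close>, and with \<open>g\<close>, which then puts \<open>g\<close> into \<open>C(z) = U\<close>.\<close>

lemma nil_of_strongly_self_centralizing:
  assumes U: "strongly_self_centralizing U G" and x: "x \<in> U" "x \<noteq> \<one>"
  shows "nil_of G x = U"
proof
  have sub: "subgroup U G"
    and cent: "\<And>y. y \<in> U \<Longrightarrow> y \<noteq> \<one> \<Longrightarrow> centralizer G y = U"
    using U unfolding strongly_self_centralizing_def by auto
  show "nil_of G x \<subseteq> U"
  proof
    fix g assume g: "g \<in> nil_of G x"
    have nil: "nilpotent_subgroup (generate G {g, x}) G" and gc: "g \<in> carrier G"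
      using g unfolding nil_of_def by auto
    have xc: "x \<in> carrier G" using x(1) subgroup.mem_carrier[OF sub] by blast
    have "generate G {g, x} \<noteq> {\<one>}"
      using generate_pair_incl(2) x(2) by blast
    then obtain z where z: "z \<in> generate G {g, x}" "z \<noteq> \<one>"
      "\<And>h. h \<in> generate G {g, x} \<Longrightarrow> z \<otimes> h = h \<otimes> z"
      using nilpotent_subgroup_obtains_central[OF nil] by blast
    have "z \<in> carrier G" using z(1) generate_in_carrier[of "{g, x}"] gc xc by simp
    then have "z \<in> centralizer G x"
      using z(3)[OF generate_pair_incl(2)] unfolding centralizer_def by simp
    then have "centralizer G z = U" using cent x z(2) by blast
    moreover have "g \<in> centralizer G z"
      using gc z(3)[OF generate_pair_incl(1)] unfolding centralizer_def by simp
    ultimately show "g \<in> U" by simp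
  qed
  show "U \<subseteq> nil_of G x"
  proof
    fix g assume g: "g \<in> U"
    then have "nilpotent_subgroup (generate G {g, x}) G"
      using x(1) strongly_self_centralizing_nilpotent[OF U]
      by (intro nilpotent_subgroup_generate_mono) auto
    then show "g \<in> nil_of G x"
      using g subgroup.mem_carrier[OF sub] unfolding nil_of_def by simp
  qed
qed

lemma one_in_nil: "\<one> \<in> nil G"
proof -
  have "nilpotent_subgroup (generate G {\<one>, x}) G" if x: "x \<in> carrier G" for x
  proof (rule nilpotent_subgroup_if_commuting)
    show "subgroup (generate G {\<one>, x}) G" using x by (intro generate_is_subgroup) auto
    \<comment> \<open>The generators \<open>1\<close> and \<open>x\<close> commute, that is, they commute modulo the trivial subgroup.\<close>
    fix a b assume "a \<in> generate G {\<one>, x}" "b \<in> generate G {\<one>, x}"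
    then have "commutator a b \<in> {\<one>}"
      by (rule commutator_generate_into_normal[OF one_is_normal, rotated 3]) (use x commutator_eq_one_iff in auto)
    then show "a \<otimes> b = b \<otimes> a"
      using commutator_eq_one_iff generate_in_carrier[of "{\<one>, x}"] x
        \<open>a \<in> generate G {\<one>, x}\<close> \<open>b \<in> generate G {\<one>, x}\<close> by auto
  qed
  then show ?thesis unfolding nil_def nil_of_def by auto
qed

text \<open>An element \<open>z \<noteq> 1\<close> of \<open>nil(G)\<close> would lie in \<open>nil\<^sub>G(x) = U\<close> for some \<open>1 \<noteq> x \<in> U\<close>, so
  that \<open>G = nil\<^sub>G(z) = U\<close> would be abelian.\<close>

lemma nil_eq_one_if_strongly_self_centralizing:
  assumes nn: "\<not> nilpotent G" and U: "strongly_self_centralizing U G" "U \<noteq> {\<one>}"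
  shows "nil G = {\<one>}"
proof -
  have sub: "subgroup U G" using U unfolding strongly_self_centralizing_def by simp
  obtain x where x: "x \<in> U" "x \<noteq> \<one>"
    using U(2) subgroup.one_closed[OF sub] by blast
  have xc: "x \<in> carrier G" using x(1) subgroup.mem_carrier[OF sub] by blast
  have "z = \<one>" if z: "z \<in> nil G" for z
  proof (rule ccontr)
    assume "z \<noteq> \<one>"
    have "z \<in> U"
      using z xc nil_of_strongly_self_centralizing[OF U(1) x] unfolding nil_def by blast
    then have "nil_of G z = U"
      using nil_of_strongly_self_centralizing[OF U(1)] \<open>z \<noteq> \<one>\<close> by blast
    moreover have "carrier G \<subseteq> nil_of G z"
      using z unfolding nil_def nil_of_def by (auto simp: insert_commute)
    ultimately have "U = carrier G" using subgroup.subset[OF sub] by blast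
    then show False
      using nn strongly_self_centralizing_nilpotent[OF U(1)] unfolding nilpotent_subgroup_def by simp
  qed
  then show ?thesis using one_in_nil by blast
qed

end

theorem theorem3p2:
  fixes G :: "('a, 'b) monoid_scheme" and U :: "'a set"
  assumes "group G" and "finite (carrier G)" and "\<not> nilpotent G"
    and "strongly_self_centralizing U G" and "U \<noteq> {\<one>\<^bsub>G\<^esub>}"
  shows "(\<forall>x\<in>U. x \<noteq> \<one>\<^bsub>G\<^esub> \<longrightarrow> nil_of G x = U)
    \<and> \<not> Digraph_Component.connected (nilpotent_graph G)
    \<and> int (card (fitting_subgroup G)) - 1 \<le> int (clique_number (nilpotent_graph G))"
proof -
  interpret group G by fact
  have sub: "subgroup U G" using assms(4) unfolding strongly_self_centralizing_def by simp
  have nil: "nil G = {\<one>\<^bsub>G\<^esub>}"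
    by (rule nil_eq_one_if_strongly_self_centralizing[OF assms(3-5)])
  have nil_of: "nil_of G x = U" if "x \<in> U" "x \<noteq> \<one>\<^bsub>G\<^esub>" for x
    by (rule nil_of_strongly_self_centralizing[OF assms(4) that])
  have disconnected: "\<not> Digraph_Component.connected (nilpotent_graph G)"
  proof -
    obtain u where u: "u \<in> U" "u \<noteq> \<one>\<^bsub>G\<^esub>"
      using assms(5) subgroup.one_closed[OF sub] by blast
    have "U \<noteq> carrier G"
      using assms(3) strongly_self_centralizing_nilpotent[OF assms(4)]
      unfolding nilpotent_subgroup_def by auto
    then obtain v where v: "v \<in> carrier G" "v \<notin> U"
      using subgroup.subset[OF sub] by blast
    show ?thesis
    proof (rule not_connected_if_no_crossing_arc[where A = U])
      show "u \<in> verts (nilpotent_graph G)" "v \<in> verts (nilpotent_graph G)"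
        using u v subgroup.mem_carrier[OF sub] subgroup.one_closed[OF sub]
        unfolding nilpotent_graph_def nil by auto
      fix a b assume "(a, b) \<in> arcs_ends (nilpotent_graph G)"
      then have ab: "a \<in> carrier G" "b \<in> carrier G" "a \<noteq> \<one>\<^bsub>G\<^esub>" "b \<noteq> \<one>\<^bsub>G\<^esub>"
        and nilp: "nilpotent_subgroup (generate G {a, b}) G"
        unfolding nilpotent_graph_def nil by auto
      have "a \<in> nil_of G b" "b \<in> nil_of G a"
        using ab nilp unfolding nil_of_def by (simp_all add: insert_commute)
      then show "a \<in> U \<longleftrightarrow> b \<in> U" using nil_of ab(3,4) by blast
    qed (use u v in auto)
  qed
  let ?F = "fitting_subgroup G"
  have F: "subgroup ?F G" "nilpotent_subgroup ?F G"
    using fitting_subgroup_normal_nilpotent[OF assms(2)] normal_imp_subgroup by blast+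
  have "card (?F - {\<one>\<^bsub>G\<^esub>}) \<le> clique_number (nilpotent_graph G)"
    unfolding nilpotent_graph_def
  proof (rule card_le_clique_number)
    show "graph (with_proj \<lparr>pverts = carrier G - nil G,
       parcs = {(g, h). g \<in> carrier G - nil G \<and> h \<in> carrier G - nil G \<and> g \<noteq> h
                        \<and> nilpotent_subgroup (generate G {g, h}) G}\<rparr>)"
      using graph_nilpotent_graph[OF assms(2)] unfolding nilpotent_graph_def .
  qed (use subgroup.mem_carrier[OF F(1)] nilpotent_subgroup_generate_mono[OF F(2)] nil in auto)
  moreover have "card (?F - {\<one>\<^bsub>G\<^esub>}) = card ?F - 1"
    using subgroup.one_closed[OF F(1)] by simp
  ultimately have "int (card ?F) - 1 \<le> int (clique_number (nilpotent_graph G))" by linarith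
  then show ?thesis using nil_of disconnected by blast
qed

end
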